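(* Let $a<b$, $K\ge1$, and let $\{(X_i,Y_i)\}_{i\ge1}$ be i.i.d. with joint density $p(x,y)=p_X(x)\sum_{k=1}^K\lambda_kf_k(y-m_k(x))$ on $[a,b]\times\mathbb{R}$, where $p_X$ is a probability density with $\inf_{[a,b]}p_X>0$, the $f_k$ are probability densities on $\mathbb{R}$ with mean zero, $\min_k\lambda_k>0$, $\sum_k\lambda_k=1$, and the $m_k$ are continuous on $[a,b]$. Assume: (i) $p(x,y)$ is $\beta$-Hölder continuous for some $\beta>0$; (ii) $\min_{j\ne k}|\lambda_j-\lambda_k|>0$; (iii) for all $j\ne k$, $\lim_{t\to\infty}\varphi_j(t)/\varphi_k(t)\in\{0,\infty\}$, where $\varphi_k$ is the characteristic function of $f_k$. Let $\widehat p_n(\cdot\,|\,x)$, $\{\widehat\lambda_{n,k}\}_{k=1}^K$, $\{\widehat f_{n,k}\}_{k=1}^K$ be estimators satisfying, with probability one, $$\|\widehat p_n(\cdot\,|\,x)-p(\cdot\,|\,x)\|_1\to0\ \ \forall x\in(a,b),\qquad \max_k\big(|\widehat\lambda_{n,k}-\lambda_k|\vee\|\widehat f_{n,k}-f_k\|_1\big)\to0\qquad(n\to\infty).$$ Let $B$ be a constant with $\max_k\|m_k\|_{L^\infty[a,b]}\le B$ and let $$(\widehat m_{n,1}(x),\dots,\widehat m_{n,K}(x))^T\in\underset{\theta\in[-B,B]^K}{\operatorname{arg\,min}}\ \Big\|\sum_{k=1}^K\widehat\lambda_{n,k}\widehat f_{n,k}(\cdot-\theta_k)-\widehat p_n(\cdot\,|\,x)\Big\|_1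 ,\qquad x\in[a,b].$$ Then with probability one, $\max_k\|\widehat m_{n,k}-m_k\|_{L^1[a,b]}\to0$ as $n\to\infty$.
   Context: $p(\cdot\,|\,x)=\sum_{k=1}^K\lambda_kf_k(\cdot-m_k(x))$ is the conditional density of $Y$ given $X=x$. $\|\cdot\|_1$ is the $L^1(\mathbb{R})$ norm. The $\widehat f_{n,k}$ are probability densities. In (iii), limit $\infty$ means the modulus of the ratio tends to $\infty$. Any minimizer may be chosen (so that $x\mapsto\widehat m_{n,k}(x)$ is measurable). *)

theory Defs
  imports "HOL-Probability.Probability"
begin

definition prob_density_on :: "real set \<Rightarrow> (real \<Rightarrow> real) \<Rightarrow> bool" where
  "prob_density_on S f \<longleftrightarrow>
     set_borel_measurable borel S f \<and> (\<forall>y\<in>S. 0 \<le> f y) \<and>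
     (\<integral>\<^sup>+y\<in>S. ennreal (f y) \<partial>lborel) = 1"

(* Meaningful only for Borel measurable g; it is infinite when g is not in L^1(S), so that no
   junk value 0 arises for non-integrable functions. *)
definition L1_norm :: "real set \<Rightarrow> (real \<Rightarrow> real) \<Rightarrow> ennreal" where
  "L1_norm S g = (\<integral>\<^sup>+y\<in>S. ennreal \<bar>g y\<bar> \<partial>lborel)"

definition holder_continuous_on :: "real \<Rightarrow> 'a::metric_space set \<Rightarrow> ('a \<Rightarrow> real) \<Rightarrow> bool" where
  "holder_continuous_on \<beta> S g \<longleftrightarrow>
     (\<exists>C. \<forall>u\<in>S. \<forall>v\<in>S. \<bar>g u - g v\<bar> \<le> C * dist u v powr \<beta>)"

definition location_mixture ::
  "nat \<Rightarrow> (nat \<Rightarrow> real) \<Rightarrow> (nat \<Rightarrow> real \<Rightarrow> real) \<Rightarrow> (nat \<Rightarrow> real) \<Rightarrow> real \<Rightarrow> real" where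
  "location_mixture K w f \<theta> y = (\<Sum>k\<in>{1..K}. w k * f k (y - \<theta> k))"

definition cond_density ::
  "nat \<Rightarrow> (nat \<Rightarrow> real) \<Rightarrow> (nat \<Rightarrow> real \<Rightarrow> real) \<Rightarrow> (nat \<Rightarrow> real \<Rightarrow> real) \<Rightarrow> real \<Rightarrow> real \<Rightarrow> real" where
  "cond_density K w f m x = location_mixture K w f (\<lambda>k. m k x)"

definition char_fun :: "(real \<Rightarrow> real) \<Rightarrow> real \<Rightarrow> complex" where
  "char_fun f = char (density lborel (\<lambda>y. ennreal (f y)))"

(* An estimator based on n observations is a function of the sample
   (X_1,Y_1), ..., (X_n,Y_n), which is encoded as a function on the indices {1..n}. *)
definition sample ::
  "(nat \<Rightarrow> 'w \<Rightarrow> real) \<Rightarrow> (nat \<Rightarrow> 'w \<Rightarrow> real) \<Rightarrow> nat \<Rightarrow> 'w \<Rightarrow> (nat \<Rightarrow> real \<times> real)" where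
  "sample X Y n \<omega> = (\<lambda>i\<in>{1..n}. (X i \<omega>, Y i \<omega>))"

(* The limit of \<phi>/\<psi> at infinity exists in {0, \<infinity>}.  The first conjunct says that the quotient is
   defined for all large t; without it, the convention z / 0 = 0 could produce a spurious limit 0. *)
definition ratio_limit_zero_or_infinity :: "(real \<Rightarrow> complex) \<Rightarrow> (real \<Rightarrow> complex) \<Rightarrow> bool" where
  "ratio_limit_zero_or_infinity \<phi> \<psi> \<longleftrightarrow>
     (\<forall>\<^sub>F t in at_top. \<psi> t \<noteq> 0) \<and>
     (((\<lambda>t. \<phi> t / \<psi> t) \<longlongrightarrow> 0) at_top \<or> filterlim (\<lambda>t. \<phi> t / \<psi> t) at_infinity at_top)"

end

theory Submission
  imports Defs
begin

text \<open>
  Fix a sample point and \<open>x\<close> in the open interval. By the triangle inequality and minimality, the mixtures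
  with the true \<open>lam\<close>, \<open>f\<close> and the estimated locations converge in $L^1$ to the true conditional
  density, hence so do their Fourier transforms pointwise. Along a subsequence the bounded locations converge
  to some \<open>l\<close>, and \<open>\<Sum>k. lam k * char_fun (f k) t * (iexp (t * l k) - iexp (t * m k x)) = 0\<close> for all \<open>t\<close>.
  Under the ratio condition the component with the dominant characteristic function can be peeled off,
  which forces \<open>l k = m k x\<close>. So the estimators converge pointwise, and as they are bounded by \<open>B\<close>,
  dominated convergence concludes.
\<close>

section \<open>The $L^1$ norm and its behaviour on location mixtures\<close>

lemma prob_density_UNIV:
  assumes "prob_density_on UNIV f"
  shows "f \<in> borel_measurable borel" "\<And>y. 0 \<le> f y" "L1_norm UNIV f = 1" "integrable lborel f"
proof -
  show meas [measurable]: "f \<in> borel_measurable borel"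
    using assms by (simp add: prob_density_on_def set_borel_measurable_def)
  show nonneg: "\<And>y. 0 \<le> f y"
    using assms by (simp add: prob_density_on_def)
  show "L1_norm UNIV f = 1"
    using assms nonneg by (simp add: prob_density_on_def L1_norm_def)
  show "integrable lborel f"
    using assms nonneg by (intro integrableI_bounded) (auto simp: prob_density_on_def)
qed

lemma L1_norm_minus_commute: "L1_norm S (\<lambda>y. g y - h y) = L1_norm S (\<lambda>y. h y - g y)"
  by (simp add: L1_norm_def abs_minus_commute)

lemma L1_norm_add:
  assumes [measurable]: "g \<in> borel_measurable borel" "h \<in> borel_measurable borel"
  shows "L1_norm UNIV (\<lambda>y. g y + h y) \<le> L1_norm UNIV g + L1_norm UNIV h"
proof -
  have "L1_norm UNIV (\<lambda>y. g y + h y) \<le> (\<integral>\<^sup>+y. ennreal \<bar>g y\<bar> + ennreal \<bar>h y\<bar> \<partial>lborel)"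
    unfolding L1_norm_def
    by (intro nn_integral_mono) (auto simp flip: ennreal_plus intro!: ennreal_leI)
  also have "\<dots> = L1_norm UNIV g + L1_norm UNIV h"
    unfolding L1_norm_def by (subst nn_integral_add) auto
  finally show ?thesis .
qed

lemma L1_norm_triangle:
  assumes [measurable]: "g \<in> borel_measurable borel" "u \<in> borel_measurable borel"
    "h \<in> borel_measurable borel"
  shows "L1_norm UNIV (\<lambda>y. g y - h y)
    \<le> L1_norm UNIV (\<lambda>y. g y - u y) + L1_norm UNIV (\<lambda>y. u y - h y)"
  using L1_norm_add[of "\<lambda>y. g y - u y" "\<lambda>y. u y - h y"] by simp

lemma L1_norm_sum:
  assumes "finite A" "\<And>k. k \<in> A \<Longrightarrow> g k \<in> borel_measurable borel"
  shows "L1_norm UNIV (\<lambda>y. \<Sum>k\<in>A. g k y) \<le> (\<Sum>k\<in>A. L1_norm UNIV (g k))"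
  using assms
proof (induction rule: finite_induct)
  case empty
  then show ?case by (simp add: L1_norm_def)
next
  case (insert k A)
  then have [measurable]: "(\<lambda>y. \<Sum>k\<in>A. g k y) \<in> borel_measurable borel"
    by (intro borel_measurable_sum) auto
  have "L1_norm UNIV (\<lambda>y. \<Sum>k\<in>insert k A. g k y)
      \<le> L1_norm UNIV (g k) + L1_norm UNIV (\<lambda>y. \<Sum>k\<in>A. g k y)"
    using insert L1_norm_add[of "g k" "\<lambda>y. \<Sum>k\<in>A. g k y"] by simp
  also have "\<dots> \<le> L1_norm UNIV (g k) + (\<Sum>k\<in>A. L1_norm UNIV (g k))"
    using insert by (intro add_mono) auto
  finally show ?case using insert by simp
qed

lemma L1_norm_cmult:
  assumes [measurable]: "g \<in> borel_measurable borel"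
  shows "L1_norm UNIV (\<lambda>y. c * g y) = ennreal \<bar>c\<bar> * L1_norm UNIV g"
  by (simp add: L1_norm_def abs_mult ennreal_mult nn_integral_cmult)

lemma L1_norm_shift:
  assumes [measurable]: "g \<in> borel_measurable borel"
  shows "L1_norm UNIV (\<lambda>y. g (y - c)) = L1_norm UNIV g"
  using nn_integral_real_affine[of "\<lambda>y. ennreal \<bar>g y\<bar>" 1 "- c"]
  by (simp add: L1_norm_def)

lemma location_mixture_measurable:
  assumes "\<And>k. k \<in> {1..K} \<Longrightarrow> f k \<in> borel_measurable borel"
  shows "location_mixture K w f \<theta> \<in> borel_measurable borel"
proof -
  have "(\<lambda>y. w k * f k (y - \<theta> k)) \<in> borel_measurable borel" if "k \<in> {1..K}" for k
    using assms[OF that, measurable] by measurable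
  then show ?thesis
    unfolding location_mixture_def[abs_def] by (intro borel_measurable_sum) auto
qed

text \<open>Translation preserves the $L^1$ norm, so the bound does not depend on the locations
  \<open>\<theta>\<close>. This uniformity is what allows it to be applied at the estimated
  locations, which vary with \<open>n\<close>.\<close>

lemma L1_norm_location_mixture_diff:
  assumes f: "\<And>k. k \<in> {1..K} \<Longrightarrow> prob_density_on UNIV (f k)"
    and g: "\<And>k. k \<in> {1..K} \<Longrightarrow> prob_density_on UNIV (g k)"
  shows "L1_norm UNIV (\<lambda>y. location_mixture K v g \<theta> y - location_mixture K w f \<theta> y)
    \<le> (\<Sum>k\<in>{1..K}. ennreal \<bar>v k - w k\<bar>
          + ennreal \<bar>w k\<bar> * L1_norm UNIV (\<lambda>y. g k y - f k y))"
proof -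
  define d where "d k y = v k * g k (y - \<theta> k) - w k * f k (y - \<theta> k)" for k y
  have "L1_norm UNIV (d k) \<le> ennreal \<bar>v k - w k\<bar>
          + ennreal \<bar>w k\<bar> * L1_norm UNIV (\<lambda>y. g k y - f k y)"
    and "d k \<in> borel_measurable borel" if k: "k \<in> {1..K}" for k
  proof -
    note [measurable] = prob_density_UNIV(1)[OF f[OF k]] prob_density_UNIV(1)[OF g[OF k]]
    show "d k \<in> borel_measurable borel"
      unfolding d_def[abs_def] by measurable
    \<comment> \<open>Adding and subtracting \<open>w k * g k\<close> separates the error in the
      weight, multiplied by a density of norm one, from the error in the density.\<close>
    have "d k = (\<lambda>y. (v k - w k) * g k (y - \<theta> k) + w k * (g k (y - \<theta> k) - f k (y - \<theta> k)))"
      by (simp add: d_def fun_eq_iff algebra_simps)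
    then have "L1_norm UNIV (d k) \<le> L1_norm UNIV (\<lambda>y. (v k - w k) * g k (y - \<theta> k))
        + L1_norm UNIV (\<lambda>y. w k * (g k (y - \<theta> k) - f k (y - \<theta> k)))"
      using L1_norm_add[of "\<lambda>y. (v k - w k) * g k (y - \<theta> k)"
          "\<lambda>y. w k * (g k (y - \<theta> k) - f k (y - \<theta> k))"] by simp
    also have "\<dots> = ennreal \<bar>v k - w k\<bar>
          + ennreal \<bar>w k\<bar> * L1_norm UNIV (\<lambda>y. g k y - f k y)"
      using L1_norm_shift[of "g k" "\<theta> k"] L1_norm_shift[of "\<lambda>y. g k y - f k y" "\<theta> k"]
        prob_density_UNIV(3)[OF g[OF k]]
      by (simp add: L1_norm_cmult)
    finally show "L1_norm UNIV (d k) \<le> ennreal \<bar>v k - w k\<bar>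
          + ennreal \<bar>w k\<bar> * L1_norm UNIV (\<lambda>y. g k y - f k y)" .
  qed
  then have "(\<Sum>k\<in>{1..K}. L1_norm UNIV (d k)) \<le> (\<Sum>k\<in>{1..K}. ennreal \<bar>v k - w k\<bar>
          + ennreal \<bar>w k\<bar> * L1_norm UNIV (\<lambda>y. g k y - f k y))"
    and "L1_norm UNIV (\<lambda>y. \<Sum>k\<in>{1..K}. d k y) \<le> (\<Sum>k\<in>{1..K}. L1_norm UNIV (d k))"
    by (auto intro!: sum_mono L1_norm_sum)
  then show ?thesis
    by (auto simp: location_mixture_def d_def sum_subtractf intro: order_trans)
qed

section \<open>Fourier transforms of densities and location mixtures\<close>

lemma char_fun_eq:
  assumes "prob_density_on UNIV f"
  shows "char_fun f t = (LINT y|lborel. f y *\<^sub>R iexp (t * y))"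
  unfolding char_fun_def char_def
  using prob_density_UNIV[OF assms] by (subst integral_density) auto

lemma integrable_scaleR_iexp:
  assumes "integrable lborel f"
  shows "integrable lborel (\<lambda>y. f y *\<^sub>R iexp (t * y))"
proof (rule Bochner_Integration.integrable_bound[OF assms])
  show "(\<lambda>y. f y *\<^sub>R iexp (t * y)) \<in> borel_measurable lborel"
    using borel_measurable_integrable[OF assms] by measurable
qed auto

lemma fourier_shift:
  fixes f :: "real \<Rightarrow> real"
  shows "(LINT y|lborel. f (y - c) *\<^sub>R iexp (t * y))
    = iexp (t * c) * (LINT y|lborel. f y *\<^sub>R iexp (t * y))"
proof -
  have "(LINT y|lborel. f (y - c) *\<^sub>R iexp (t * y))
      = (LINT y|lborel. f y *\<^sub>R iexp (t * (c + y)))"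
    using lborel_integral_real_affine[of 1 "\<lambda>y. f (y - c) *\<^sub>R iexp (t * y)" c] by simp
  also have "\<dots> = (LINT y|lborel. iexp (t * c) * (f y *\<^sub>R iexp (t * y)))"
    by (simp add: distrib_left exp_add algebra_simps scaleR_conv_of_real)
  also have "\<dots> = iexp (t * c) * (LINT y|lborel. f y *\<^sub>R iexp (t * y))"
    by (rule integral_mult_right_zero)
  finally show ?thesis .
qed

text \<open>A Fourier transform is bounded pointwise by the $L^1$ norm, and translating a component
  by \<open>\<theta> k\<close> multiplies its transform by \<open>iexp (t * \<theta> k)\<close>.
  Thus $L^1$ closeness of mixtures becomes, for each fixed \<open>t\<close>, smallness of an
  expression that is continuous in the locations.\<close>

lemma norm_char_fun_mixture_diff_le:
  assumes f: "\<And>k. k \<in> {1..K} \<Longrightarrow> prob_density_on UNIV (f k)"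
  shows "ennreal (norm (\<Sum>k\<in>{1..K}. of_real (w k) * char_fun (f k) t
            * (iexp (t * \<theta> k) - iexp (t * \<eta> k))))
    \<le> L1_norm UNIV (\<lambda>y. location_mixture K w f \<theta> y - location_mixture K w f \<eta> y)"
proof -
  have int_shift: "integrable lborel (\<lambda>y. f k (y - c))" if "k \<in> {1..K}" for k c
    using lborel_integrable_real_affine[OF prob_density_UNIV(4)[OF f[OF that]], of 1 "- c"]
    by simp
  have int_mix: "integrable lborel (location_mixture K w f c)" for c
    unfolding location_mixture_def[abs_def]
    by (intro Bochner_Integration.integrable_sum integrable_mult_right int_shift)
  have trans: "(LINT y|lborel. location_mixture K w f c y *\<^sub>R iexp (t * y))
      = (\<Sum>k\<in>{1..K}. of_real (w k) * char_fun (f k) t * iexp (t * c k))" for c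
  proof -
    have "(LINT y|lborel. location_mixture K w f c y *\<^sub>R iexp (t * y))
        = (LINT y|lborel. (\<Sum>k\<in>{1..K}. of_real (w k) * (f k (y - c k) *\<^sub>R iexp (t * y))))"
      by (simp add: location_mixture_def scaleR_sum_left scaleR_conv_of_real sum_distrib_right mult.assoc)
    also have "\<dots> = (\<Sum>k\<in>{1..K}. LINT y|lborel. of_real (w k) * (f k (y - c k) *\<^sub>R iexp (t * y)))"
      by (intro Bochner_Integration.integral_sum integrable_mult_right integrable_scaleR_iexp int_shift)
    also have "\<dots> = (\<Sum>k\<in>{1..K}. of_real (w k) * (LINT y|lborel. f k (y - c k) *\<^sub>R iexp (t * y)))"
      by (intro sum.cong refl integral_mult_right_zero)
    also have "\<dots> = (\<Sum>k\<in>{1..K}. of_real (w k) * char_fun (f k) t * iexp (t * c k))"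
      by (intro sum.cong refl) (subst fourier_shift, simp add: char_fun_eq[OF f] mult.commute)
    finally show ?thesis .
  qed
  let ?d = "\<lambda>y. location_mixture K w f \<theta> y - location_mixture K w f \<eta> y"
  have "(LINT y|lborel. ?d y *\<^sub>R iexp (t * y))
      = (\<Sum>k\<in>{1..K}. of_real (w k) * char_fun (f k) t * (iexp (t * \<theta> k) - iexp (t * \<eta> k)))"
    using Bochner_Integration.integral_diff[OF integrable_scaleR_iexp[OF int_mix[of \<theta>], of t]
        integrable_scaleR_iexp[OF int_mix[of \<eta>], of t]]
    by (simp only: trans right_diff_distrib sum_subtractf scaleR_left_diff_distrib)
  moreover have "ennreal (norm (LINT y|lborel. ?d y *\<^sub>R iexp (t * y))) \<le> L1_norm UNIV ?d"
    using integral_norm_bound_ennreal[OF integrable_scaleR_iexp[of ?d t]] int_mix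
    by (simp add: L1_norm_def)
  ultimately show ?thesis by simp
qed

section \<open>Identifiability of the locations\<close>

lemma char_fun_nonzero_near_0:
  assumes "prob_density_on UNIV f"
  shows "\<forall>\<^sub>F t in at_right 0. char_fun f t \<noteq> 0"
proof -
  have "real_distribution (density lborel (\<lambda>y. ennreal (f y)))"
  proof (intro real_distribution.intro real_distribution_axioms.intro prob_spaceI)
    show "emeasure (density lborel (\<lambda>y. ennreal (f y))) (space (density lborel (\<lambda>y. ennreal (f y)))) = 1"
      using assms prob_density_UNIV[OF assms] by (simp add: emeasure_density prob_density_on_def)
  qed auto
  \<comment> \<open>Nonvanishing near 0 follows from continuity at 0, where the value is 1.\<close>
  then have "isCont (char_fun f) 0" "char_fun f 0 = 1"
    unfolding char_fun_def
    by (auto intro: real_distribution.isCont_char real_distribution.char_zero)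
  then have "((char_fun f) \<longlongrightarrow> 1) (at_right 0)"
    by (metis isCont_def filterlim_at_split)
  then show ?thesis
    by (rule tendsto_imp_eventually_ne) simp
qed

text \<open>At odd multiples of \<open>pi / \<bar>u - v\<bar>\<close> the two exponentials are
  opposite, so their difference has modulus 2 along a sequence tending to infinity.\<close>

lemma iexp_diff_not_tendsto_0:
  fixes u v :: real
  assumes "u \<noteq> v"
  shows "\<not> ((\<lambda>t. iexp (t * u) - iexp (t * v)) \<longlongrightarrow> 0) at_top"
proof
  assume lim: "((\<lambda>t. iexp (t * u) - iexp (t * v)) \<longlongrightarrow> 0) at_top"
  define s where "s n = (2 * real n + 1) * (pi / \<bar>u - v\<bar>)" for n
  have "filterlim (\<lambda>n. 2 * real n + 1) at_top sequentially"
    by (rule filterlim_at_top_mono[OF filterlim_real_sequentially]) auto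
  then have "filterlim s at_top sequentially"
    unfolding s_def using assms
    by (subst mult.commute) (rule filterlim_tendsto_pos_mult_at_top[OF tendsto_const], simp_all)
  then have "(\<lambda>n. norm (iexp (s n * u) - iexp (s n * v))) \<longlonglongrightarrow> 0"
    using tendsto_norm_zero[OF filterlim_compose[OF lim]] by simp
  moreover have "norm (iexp (s n * u) - iexp (s n * v)) = 2" for n
  proof -
    have "s n * \<bar>u - v\<bar> = real (2 * n + 1) * pi"
      using assms by (simp add: s_def)
    then have "cos (s n * \<bar>u - v\<bar>) = - 1" "sin (s n * \<bar>u - v\<bar>) = 0"
      by (simp_all only: cos_npi sin_npi) simp
    \<comment> \<open>The sign of \<open>u - v\<close> does not matter: cosine is even, and the sine
      vanishes.\<close>
    then have "cis (s n * (u - v)) = - 1"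
      by (cases "u \<ge> v") (auto simp: complex_eq_iff abs_if right_diff_distrib cos_diff sin_diff algebra_simps)
    then have "iexp (s n * u) = - iexp (s n * v)"
      by (simp add: cis_conv_exp right_diff_distrib exp_diff divide_eq_eq)
    then have "norm (iexp (s n * u) - iexp (s n * v)) = norm (- 2 * iexp (s n * v))"
      by simp
    then show ?thesis
      by (simp only: norm_mult norm_exp_i_times) simp
  qed
  ultimately show False
    by (simp add: LIMSEQ_const_iff)
qed

text \<open>Equality at a single \<open>t\<close> only determines \<open>t * (u - v)\<close> modulo
  \<open>2 * pi\<close>. A small positive \<open>t\<close> excludes every nonzero multiple, because
  the sine is positive strictly between 0 and \<open>pi\<close>.\<close>

lemma iexp_eq_near_0:
  fixes u v :: real
  assumes "\<forall>\<^sub>F t in at_right 0. iexp (t * u) = iexp (t * v)"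
  shows "u = v"
proof (rule ccontr)
  assume "u \<noteq> v"
  obtain d where d: "d > 0" "\<And>t. 0 < t \<Longrightarrow> t < d \<Longrightarrow> iexp (t * u) = iexp (t * v)"
    using assms by (auto simp: eventually_at_right_field)
  \<comment> \<open>The first bound keeps \<open>t\<close> where the exponentials agree, the second
    keeps the angle \<open>t * \<bar>u - v\<bar>\<close> at or below \<open>pi / 2\<close>.\<close>
  define t where "t = min (d / 2) (pi / (2 * \<bar>u - v\<bar>))"
  have t: "0 < t" "t < d" "t * \<bar>u - v\<bar> < pi"
    using d(1) \<open>u \<noteq> v\<close> pi_gt_zero mult_right_mono[of t "pi / (2 * \<bar>u - v\<bar>)" "\<bar>u - v\<bar>"]
    by (auto simp: t_def simp del: pi_gt_zero)
  have "cis (t * (u - v)) = iexp (t * u) / iexp (t * v)"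
    by (simp add: right_diff_distrib cis_conv_exp exp_diff)
  also have "\<dots> = 1"
    by (subst d(2)[OF t(1,2)]) simp
  finally have "sin (t * (u - v)) = 0"
    by (simp add: complex_eq_iff)
  then have "sin (t * \<bar>u - v\<bar>) = 0"
    using sin_minus[of "t * (u - v)"] by (cases "u \<ge> v") (simp_all add: algebra_simps)
  then show False
    using sin_gt_zero[of "t * \<bar>u - v\<bar>"] t \<open>u \<noteq> v\<close> by simp
qed

text \<open>The ratio condition makes any two of the functions comparable in order of magnitude at
  infinity, and negligibility is transitive. The induction keeps a running maximum: the new index
  \<open>l\<close> replaces \<open>k\<close> exactly when \<open>\<phi> l\<close> is not negligible
  against \<open>\<phi> k\<close>.\<close>

lemma ex_dominant:
  fixes \<phi> :: "'i \<Rightarrow> real \<Rightarrow> complex"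
  assumes "finite S" "S \<noteq> {}"
    and "\<And>j k. j \<in> S \<Longrightarrow> k \<in> S \<Longrightarrow> j \<noteq> k \<Longrightarrow> ratio_limit_zero_or_infinity (\<phi> j) (\<phi> k)"
  obtains k where "k \<in> S" "\<And>j. j \<in> S \<Longrightarrow> j \<noteq> k \<Longrightarrow> ((\<lambda>t. \<phi> j t / \<phi> k t) \<longlongrightarrow> 0) at_top"
proof -
  have "\<exists>k\<in>S. \<forall>j\<in>S. j \<noteq> k \<longrightarrow> ((\<lambda>t. \<phi> j t / \<phi> k t) \<longlongrightarrow> 0) at_top"
    using assms
  proof (induction rule: finite_ne_induct)
    case (singleton x)
    then show ?case by simp
  next
    case (insert l S)
    then obtain k where k: "k \<in> S" "\<And>j. j \<in> S \<Longrightarrow> j \<noteq> k \<Longrightarrow> ((\<lambda>t. \<phi> j t / \<phi> k t) \<longlongrightarrow> 0) at_top"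
      by (metis insertI2)
    have kl: "k \<noteq> l" using k insert by auto
    then have rl: "ratio_limit_zero_or_infinity (\<phi> l) (\<phi> k)" "ratio_limit_zero_or_infinity (\<phi> k) (\<phi> l)"
      using insert.prems[of l k] insert.prems[of k l] k by auto
    show ?case
    proof (cases "((\<lambda>t. \<phi> l t / \<phi> k t) \<longlongrightarrow> 0) at_top")
      case True
      then show ?thesis using k by (intro bexI[of _ k]) auto
    next
      case False
      \<comment> \<open>With the limit 0 excluded, the ratio tends to infinity and its inverse to
        0.\<close>
      then have "((\<lambda>t. inverse (\<phi> l t / \<phi> k t)) \<longlongrightarrow> 0) at_top"
        using rl(1) filterlim_compose[OF tendsto_inverse_0, of "\<lambda>t. \<phi> l t / \<phi> k t" at_top]
        unfolding ratio_limit_zero_or_infinity_def by blast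
      then have l: "((\<lambda>t. \<phi> k t / \<phi> l t) \<longlongrightarrow> 0) at_top"
        by simp
      have "((\<lambda>t. \<phi> j t / \<phi> l t) \<longlongrightarrow> 0) at_top" if "j \<in> S" "j \<noteq> k" for j
      proof -
        have "((\<lambda>t. (\<phi> j t / \<phi> k t) * (\<phi> k t / \<phi> l t)) \<longlongrightarrow> 0) at_top"
          using tendsto_mult[OF k(2)[OF that] l] by simp
        \<comment> \<open>Cancelling \<open>\<phi> k t\<close> is legitimate only where it is
          nonzero; the first conjunct of the ratio condition provides this for all large
          \<open>t\<close>.\<close>
        moreover have "\<forall>\<^sub>F t in at_top. (\<phi> j t / \<phi> k t) * (\<phi> k t / \<phi> l t) = \<phi> j t / \<phi> l t"
          using conjunct1[OF rl(1)[unfolded ratio_limit_zero_or_infinity_def]]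
          by (rule eventually_mono) simp
        ultimately show ?thesis
          by (rule Lim_transform_eventually)
      qed
      then show ?thesis using l by (intro bexI[of _ l]) auto
    qed
  qed
  then show ?thesis using that by blast
qed

text \<open>
  Let \<open>T\<close> be the set of components with \<open>u k \<noteq> v k\<close>. Dividing by the dominant \<open>\<phi> k\<close>, \<open>k \<in> T\<close>,
  leaves \<open>iexp (t * u k) - iexp (t * v k) \<longlongrightarrow> 0\<close>, which is absurd. If \<open>T\<close> is a singleton, the ratio
  condition may be void, so that \<open>\<phi> k\<close> could vanish for all large \<open>t\<close>; then \<open>t\<close> near \<open>0\<close> is used.
\<close>

lemma location_identifiable:
  fixes \<phi> :: "'i \<Rightarrow> real \<Rightarrow> complex" and u v :: "'i \<Rightarrow> real"
  assumes "finite S"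
    and c: "\<And>k. k \<in> S \<Longrightarrow> c k \<noteq> 0"
    and near_0: "\<And>k. k \<in> S \<Longrightarrow> \<forall>\<^sub>F t in at_right 0. \<phi> k t \<noteq> 0"
    and ratio: "\<And>j k. j \<in> S \<Longrightarrow> k \<in> S \<Longrightarrow> j \<noteq> k \<Longrightarrow> ratio_limit_zero_or_infinity (\<phi> j) (\<phi> k)"
    and zero: "\<And>t. (\<Sum>k\<in>S. c k * \<phi> k t * (iexp (t * u k) - iexp (t * v k))) = 0"
    and "k \<in> S"
  shows "u k = v k"
proof -
  define T where "T = {k \<in> S. u k \<noteq> v k}"
  have T: "finite T" "T \<subseteq> S" "\<And>k. k \<in> T \<Longrightarrow> u k \<noteq> v k"
    using \<open>finite S\<close> by (auto simp: T_def)
  have zeroT: "(\<Sum>k\<in>T. c k * \<phi> k t * (iexp (t * u k) - iexp (t * v k))) = 0" for t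
    using zero[of t] \<open>finite S\<close>
    by (subst sum.mono_neutral_left[of S T]) (auto simp: T_def)
  have "T = {}"
  proof (rule ccontr)
    assume "T \<noteq> {}"
    then obtain k where k: "k \<in> T"
      "\<And>j. j \<in> T \<Longrightarrow> j \<noteq> k \<Longrightarrow> ((\<lambda>t. \<phi> j t / \<phi> k t) \<longlongrightarrow> 0) at_top"
      using ex_dominant[of T \<phi>] T ratio by (metis subsetD)
    show False
    proof (cases "T = {k}")
      case True
      have "\<forall>\<^sub>F t in at_right 0. iexp (t * u k) = iexp (t * v k)"
      proof (rule eventually_mono)
        show "\<forall>\<^sub>F t in at_right 0. \<phi> k t \<noteq> 0"
          using near_0 k T(2) by blast
        show "iexp (t * u k) = iexp (t * v k)" if "\<phi> k t \<noteq> 0" for t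
          using zeroT[of t] True c[of k] k T(2) that by auto
      qed
      then show False
        using iexp_eq_near_0 T(3) k by blast
    next
      case False
      \<comment> \<open>A second index in \<open>T\<close> makes the ratio condition available with
        \<open>\<phi> k\<close> as denominator, hence \<open>\<phi> k\<close> is eventually
        nonzero.\<close>
      then obtain j where "j \<in> T" "j \<noteq> k" using k by auto
      then have nz: "\<forall>\<^sub>F t in at_top. \<phi> k t \<noteq> 0"
        using ratio[of j k] k T(2) by (auto simp: ratio_limit_zero_or_infinity_def)
      let ?r = "\<lambda>j t. c j * (\<phi> j t / \<phi> k t) * (iexp (t * u j) - iexp (t * v j))"
      have "(?r j \<longlongrightarrow> 0) at_top" if "j \<in> T - {k}" for j
      proof (rule Lim_null_comparison)
        show "\<forall>\<^sub>F t in at_top. norm (?r j t) \<le> norm (c j * (\<phi> j t / \<phi> k t)) * 2"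
        proof (intro always_eventually allI)
          fix t
          have "norm (iexp (t * u j) - iexp (t * v j)) \<le> 2"
            by (rule order_trans[OF norm_triangle_ineq4]) simp
          then show "norm (?r j t) \<le> norm (c j * (\<phi> j t / \<phi> k t)) * 2"
            unfolding norm_mult[of _ "iexp _ - _"] by (rule mult_left_mono) simp
        qed
        show "((\<lambda>t. norm (c j * (\<phi> j t / \<phi> k t)) * 2) \<longlongrightarrow> 0) at_top"
          using k(2)[of j] that
          by (intro tendsto_mult_left_zero tendsto_norm_zero tendsto_mult_right_zero) auto
      qed
      \<comment> \<open>Each term other than the dominant one is a null ratio times a factor bounded
        by 2. The vanishing sum is next solved for the exponential difference of index
        \<open>k\<close>, which therefore has the same limit.\<close>
      then have lim: "((\<lambda>t. - (\<Sum>j\<in>T - {k}. ?r j t) / c k) \<longlongrightarrow> 0) at_top"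
        using tendsto_divide_zero[of "\<lambda>t. - (\<Sum>j\<in>T - {k}. ?r j t)" at_top "c k"]
          tendsto_minus[OF tendsto_null_sum[of "T - {k}" "\<lambda>t j. ?r j t" at_top]]
        by (simp only: minus_zero)
      have "\<forall>\<^sub>F t in at_top. - (\<Sum>j\<in>T - {k}. ?r j t) / c k = iexp (t * u k) - iexp (t * v k)"
        using nz
      proof (elim eventually_mono)
        fix t assume nz: "\<phi> k t \<noteq> 0"
        have "(\<Sum>j\<in>T. ?r j t) = (\<Sum>j\<in>T. c j * \<phi> j t * (iexp (t * u j) - iexp (t * v j))) / \<phi> k t"
          by (simp add: sum_divide_distrib)
        also have "\<dots> = 0" by (simp only: zeroT div_0)
        finally have "?r k t = - (\<Sum>j\<in>T - {k}. ?r j t)"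
          using sum.remove[OF T(1) k(1), of "\<lambda>j. ?r j t"] by (simp add: eq_neg_iff_add_eq_0)
        then show "- (\<Sum>j\<in>T - {k}. ?r j t) / c k = iexp (t * u k) - iexp (t * v k)"
          using nz c[of k] k(1) T(2) by (simp add: field_simps subset_iff)
      qed
      with lim have "((\<lambda>t. iexp (t * u k) - iexp (t * v k)) \<longlongrightarrow> 0) at_top"
        by (rule Lim_transform_eventually)
      then show False
        using iexp_diff_not_tendsto_0 T(3) k by blast
    qed
  qed
  then show ?thesis using \<open>k \<in> S\<close> by (auto simp: T_def)
qed

section \<open>Compactness and convergence of the minimizing locations\<close>

lemma bounded_family_subseq:
  fixes x :: "'i \<Rightarrow> nat \<Rightarrow> 'a::heine_borel"
  assumes "finite S" "\<And>k. k \<in> S \<Longrightarrow> bounded (range (x k))"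
  obtains r l where "strict_mono r" "\<And>k. k \<in> S \<Longrightarrow> (x k \<circ> r) \<longlonglongrightarrow> l k"
proof -
  have "\<exists>r l. strict_mono r \<and> (\<forall>k\<in>S. (x k \<circ> r) \<longlonglongrightarrow> l k)"
    using assms
  proof (induction rule: finite_induct)
    case empty
    then show ?case using strict_mono_id by blast
  next
    case (insert k S)
    then obtain r l where r: "strict_mono r" "\<And>j. j \<in> S \<Longrightarrow> (x j \<circ> r) \<longlonglongrightarrow> l j"
      by (metis insertI2)
    have "bounded (range (x k \<circ> r))"
      using insert.prems[of k] by (auto intro: bounded_subset)
    then obtain a s where s: "strict_mono s" "(x k \<circ> r \<circ> s) \<longlonglongrightarrow> a"
      using bounded_imp_convergent_subsequence by blast
    \<comment> \<open>Limits already obtained along \<open>r\<close> persist along the further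
      subsequence \<open>r \<circ> s\<close>, so one extraction per index suffices.\<close>
    have "(x j \<circ> (r \<circ> s)) \<longlonglongrightarrow> (l(k := a)) j" if "j \<in> insert k S" for j
      using that s LIMSEQ_subseq_LIMSEQ[OF r(2) s(1)] insert.hyps
      by (auto simp: comp_assoc)
    then show ?case using strict_mono_o[OF r(1) s(1)] by blast
  qed
  then show ?thesis using that by blast
qed

text \<open>Here the weights and densities are the true ones and only the locations vary. If
  coordinate \<open>k\<close> stayed away from \<open>\<eta> k\<close> infinitely often, compactness
  would give a limit point \<open>l\<close> with \<open>l k \<noteq> \<eta> k\<close>, contrary to
  identifiability.\<close>

lemma location_mixture_param_tendsto:
  assumes f: "\<And>k. k \<in> {1..K} \<Longrightarrow> prob_density_on UNIV (f k)"
    and w: "\<And>k. k \<in> {1..K} \<Longrightarrow> w k \<noteq> 0"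
    and ratio: "\<And>j k. j \<in> {1..K} \<Longrightarrow> k \<in> {1..K} \<Longrightarrow> j \<noteq> k \<Longrightarrow>
                  ratio_limit_zero_or_infinity (char_fun (f j)) (char_fun (f k))"
    and bdd: "\<And>n k. k \<in> {1..K} \<Longrightarrow> \<bar>\<theta> n k\<bar> \<le> B"
    and lim: "(\<lambda>n. L1_norm UNIV
                (\<lambda>y. location_mixture K w f (\<theta> n) y - location_mixture K w f \<eta> y)) \<longlonglongrightarrow> 0"
    and k: "k \<in> {1..K}"
  shows "(\<lambda>n. \<theta> n k) \<longlonglongrightarrow> \<eta> k"
proof (rule ccontr)
  assume "\<not> ?thesis"
  then obtain e where e: "e > 0" "\<exists>\<^sub>F n in sequentially. e \<le> dist (\<theta> n k) (\<eta> k)"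
    by (auto simp: tendsto_iff not_eventually not_less)
  then have "infinite {n. e \<le> dist (\<theta> n k) (\<eta> k)}"
    by (simp add: frequently_cofinite flip: cofinite_eq_sequentially)
  then obtain s :: "nat \<Rightarrow> nat" where s: "strict_mono s" "\<And>n. e \<le> dist (\<theta> (s n) k) (\<eta> k)"
    using infinite_enumerate by blast
  have "bounded (range (\<lambda>n. \<theta> (s n) k))" if "k \<in> {1..K}" for k
    using bdd[OF that] by (auto simp: bounded_iff)
  then obtain r l where r: "strict_mono r"
    "\<And>k. k \<in> {1..K} \<Longrightarrow> ((\<lambda>n. \<theta> (s n) k) \<circ> r) \<longlonglongrightarrow> l k"
    using bounded_family_subseq[of "{1..K}" "\<lambda>k n. \<theta> (s n) k"] by auto
  have \<theta>_lim: "(\<lambda>n. \<theta> (s (r n)) k) \<longlonglongrightarrow> l k" if "k \<in> {1..K}" for k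
    using r(2)[OF that] by (simp add: o_def)
  let ?S = "\<lambda>\<theta> t. \<Sum>k\<in>{1..K}. of_real (w k) * char_fun (f k) t * (iexp (t * \<theta> k) - iexp (t * \<eta> k))"
  \<comment> \<open>The same sequence has two limits: \<open>?S l t\<close> by continuity in the
    locations, and 0 by the $L^1$ bound on the transform.\<close>
  have zero: "?S l t = 0" for t
  proof (rule LIMSEQ_unique)
    show "(\<lambda>n. ?S (\<theta> (s (r n))) t) \<longlonglongrightarrow> ?S l t"
      by (intro tendsto_intros \<theta>_lim)
    have "(\<lambda>n. ennreal (norm (?S (\<theta> n) t))) \<longlonglongrightarrow> 0"
      by (rule tendsto_sandwich[OF _ _ tendsto_const lim])
        (use norm_char_fun_mixture_diff_le[OF f] in auto)
    then have "(\<lambda>n. ?S (\<theta> n) t) \<longlonglongrightarrow> 0"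
      by (simp add: ennreal_tendsto_0_iff tendsto_norm_zero_iff)
    from LIMSEQ_subseq_LIMSEQ[OF this strict_mono_o[OF s(1) r(1)]]
    show "(\<lambda>n. ?S (\<theta> (s (r n))) t) \<longlonglongrightarrow> 0"
      by (simp add: o_def)
  qed
  have "l k = \<eta> k"
  proof (rule location_identifiable[where S = "{1..K}" and c = "\<lambda>k. of_real (w k)"
        and \<phi> = "\<lambda>k. char_fun (f k)" and u = l and v = \<eta>])
    show "complex_of_real (w k) \<noteq> 0" if "k \<in> {1..K}" for k
      using w[OF that] by simp
    show "\<forall>\<^sub>F t in at_right 0. char_fun (f k) t \<noteq> 0" if "k \<in> {1..K}" for k
      by (intro char_fun_nonzero_near_0 f that)
    show "ratio_limit_zero_or_infinity (char_fun (f i)) (char_fun (f j))"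
      if "i \<in> {1..K}" "j \<in> {1..K}" "i \<noteq> j" for i j
      by (rule ratio[OF that])
    show "?S l t = 0" for t
      by (rule zero)
    show "k \<in> {1..K}"
      by (rule k)
  qed simp
  then have "(\<lambda>n. dist (\<theta> (s (r n)) k) (\<eta> k)) \<longlonglongrightarrow> 0"
    using \<theta>_lim[OF k] by (simp only: tendsto_dist_iff[THEN iffD1])
  then have "e \<le> 0"
    by (rule LIMSEQ_le_const) (use s(2) in auto)
  then show False using e(1) by simp
qed

text \<open>The deterministic core, at one sample point and one \<open>x\<close>: \<open>q n\<close>
  stands for the estimated conditional density, \<open>v n\<close> and \<open>g n\<close> for the
  estimated weights and component densities, and \<open>\<eta>\<close> for the true locations at
  \<open>x\<close>.\<close>

lemma minimizer_tendsto:
  assumes f: "\<And>k. k \<in> {1..K} \<Longrightarrow> prob_density_on UNIV (f k)"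
    and w: "\<And>k. k \<in> {1..K} \<Longrightarrow> w k \<noteq> 0"
    and ratio: "\<And>j k. j \<in> {1..K} \<Longrightarrow> k \<in> {1..K} \<Longrightarrow> j \<noteq> k \<Longrightarrow>
                  ratio_limit_zero_or_infinity (char_fun (f j)) (char_fun (f k))"
    and g: "\<And>n k. k \<in> {1..K} \<Longrightarrow> prob_density_on UNIV (g n k)"
    and q: "\<And>n. q n \<in> borel_measurable borel"
    and q_lim: "(\<lambda>n. L1_norm UNIV (\<lambda>y. q n y - location_mixture K w f \<eta> y)) \<longlonglongrightarrow> 0"
    and vg_lim: "(\<lambda>n. MAX k\<in>{1..K}. max (ennreal \<bar>v n k - w k\<bar>)
                   (L1_norm UNIV (\<lambda>y. g n k y - f k y))) \<longlonglongrightarrow> 0"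
    and \<eta>: "\<eta> \<in> {1..K} \<rightarrow> {-B..B}"
    and argmin: "\<And>n. is_arg_min
                   (\<lambda>\<theta>. L1_norm UNIV (\<lambda>y. location_mixture K (v n) (g n) \<theta> y - q n y))
                   (\<lambda>\<theta>. \<theta> \<in> {1..K} \<rightarrow> {-B..B}) (\<theta> n)"
    and k: "k \<in> {1..K}"
  shows "(\<lambda>n. \<theta> n k) \<longlonglongrightarrow> \<eta> k"
proof (rule location_mixture_param_tendsto[OF f w ratio _ _ k])
  have "\<theta> n \<in> {1..K} \<rightarrow> {-B..B}" for n
    using argmin[of n] by (simp add: is_arg_min_def)
  then show "\<bar>\<theta> n k\<bar> \<le> B" if "k \<in> {1..K}" for n k
    using that by (fastforce simp: Pi_iff abs_le_iff)
  \<comment> \<open>\<open>\<epsilon> n\<close> is the cost of exchanging estimated and true weights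
    and densities at arbitrary common locations; \<open>\<delta> n\<close> is the error of
    \<open>q n\<close>.\<close>
  define \<epsilon> where "\<epsilon> n = (\<Sum>k\<in>{1..K}. ennreal \<bar>v n k - w k\<bar>
      + ennreal \<bar>w k\<bar> * L1_norm UNIV (\<lambda>y. g n k y - f k y))" for n
  define \<delta> where "\<delta> n = L1_norm UNIV (\<lambda>y. q n y - location_mixture K w f \<eta> y)" for n
  have "(\<lambda>n. ennreal \<bar>v n k - w k\<bar>
      + ennreal \<bar>w k\<bar> * L1_norm UNIV (\<lambda>y. g n k y - f k y)) \<longlonglongrightarrow> 0 + ennreal \<bar>w k\<bar> * 0"
    if "k \<in> {1..K}" for k
  proof -
    have "max (ennreal \<bar>v n k - w k\<bar>) (L1_norm UNIV (\<lambda>y. g n k y - f k y))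
      \<le> (MAX k\<in>{1..K}. max (ennreal \<bar>v n k - w k\<bar>) (L1_norm UNIV (\<lambda>y. g n k y - f k y)))" for n
      using that by (intro Max_ge) auto
    then have "(\<lambda>n. ennreal \<bar>v n k - w k\<bar>) \<longlonglongrightarrow> 0"
      "(\<lambda>n. L1_norm UNIV (\<lambda>y. g n k y - f k y)) \<longlonglongrightarrow> 0"
      by (auto intro!: tendsto_sandwich[OF _ _ tendsto_const vg_lim])
    then show ?thesis
      by (intro tendsto_add ennreal_tendsto_cmult) auto
  qed
  then have \<epsilon>: "\<epsilon> \<longlonglongrightarrow> 0"
    unfolding \<epsilon>_def by (intro tendsto_null_sum) simp
  \<comment> \<open>The exchange is paid for twice, at \<open>\<theta> n\<close> and at
    \<open>\<eta>\<close>. The error of \<open>q n\<close> also enters twice: once in bounding the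
    minimum by its value at \<open>\<eta>\<close>, and once in returning from \<open>q n\<close> to
    the true mixture.\<close>
  have "L1_norm UNIV (\<lambda>y. location_mixture K w f (\<theta> n) y - location_mixture K w f \<eta> y)
      \<le> 2 * \<epsilon> n + 2 * \<delta> n" for n
  proof -
    have meas: "location_mixture K w f c \<in> borel_measurable borel"
      "location_mixture K (v n) (g n) c \<in> borel_measurable borel" for c
      using prob_density_UNIV(1) f g by (auto intro!: location_mixture_measurable)
    have pert: "L1_norm UNIV (\<lambda>y. location_mixture K (v n) (g n) c y - location_mixture K w f c y)
        \<le> \<epsilon> n" for c
      unfolding \<epsilon>_def by (intro L1_norm_location_mixture_diff f g)
    \<comment> \<open>Minimality is tested against the true locations \<open>\<eta>\<close>, which
      are feasible because they are bounded by \<open>B\<close>.\<close>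
    have "L1_norm UNIV (\<lambda>y. location_mixture K (v n) (g n) (\<theta> n) y - q n y)
        \<le> L1_norm UNIV (\<lambda>y. location_mixture K (v n) (g n) \<eta> y - q n y)"
      using argmin[of n] \<eta> by (simp add: is_arg_min_linorder)
    also have "\<dots> \<le> \<epsilon> n + \<delta> n"
      using L1_norm_triangle[OF meas(2)[of \<eta>] meas(1)[of \<eta>] q[of n]] pert[of \<eta>]
      by (auto simp: \<delta>_def L1_norm_minus_commute[of _ "q n"] intro: order_trans add_right_mono)
    finally have le: "L1_norm UNIV (\<lambda>y. location_mixture K (v n) (g n) (\<theta> n) y - q n y) \<le> \<epsilon> n + \<delta> n" .
    have "L1_norm UNIV (\<lambda>y. location_mixture K w f (\<theta> n) y - location_mixture K w f \<eta> y)
        \<le> L1_norm UNIV (\<lambda>y. location_mixture K w f (\<theta> n) y - location_mixture K (v n) (g n) (\<theta> n) y)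
          + (L1_norm UNIV (\<lambda>y. location_mixture K (v n) (g n) (\<theta> n) y - q n y) + \<delta> n)"
      using L1_norm_triangle[OF meas(1)[of "\<theta> n"] meas(2)[of "\<theta> n"] meas(1)[of \<eta>]]
        L1_norm_triangle[OF meas(2)[of "\<theta> n"] q[of n] meas(1)[of \<eta>]]
      unfolding \<delta>_def by (blast intro: order_trans add_left_mono)
    also have "\<dots> \<le> \<epsilon> n + ((\<epsilon> n + \<delta> n) + \<delta> n)"
      using pert[of "\<theta> n"] le
      by (intro add_mono order_refl) (simp_all add: L1_norm_minus_commute)
    finally show ?thesis
      by (simp only: mult_2 add.assoc add.commute add.left_commute)
  qed
  moreover have "(\<lambda>n. 2 * \<epsilon> n + 2 * \<delta> n) \<longlonglongrightarrow> 2 * 0 + 2 * 0"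
    using \<epsilon> q_lim unfolding \<delta>_def by (intro tendsto_add ennreal_tendsto_cmult) auto
  ultimately show "(\<lambda>n. L1_norm UNIV
      (\<lambda>y. location_mixture K w f (\<theta> n) y - location_mixture K w f \<eta> y)) \<longlonglongrightarrow> 0"
    using tendsto_sandwich[OF always_eventually always_eventually tendsto_const,
        of "0 :: ennreal" _ "\<lambda>n. 2 * \<epsilon> n + 2 * \<delta> n"]
    by simp
qed

section \<open>From pointwise to $L^1$ convergence, and the almost sure statement\<close>

lemma L1_norm_interval_tendsto_0:
  fixes u :: "nat \<Rightarrow> real \<Rightarrow> real"
  assumes meas: "\<And>n. set_borel_measurable borel {a..b} (u n)"
    and bound: "\<And>n x. x \<in> {a..b} \<Longrightarrow> \<bar>u n x\<bar> \<le> C"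
    and lim: "\<And>x. x \<in> {a<..<b} \<Longrightarrow> (\<lambda>n. u n x) \<longlonglongrightarrow> 0"
  shows "(\<lambda>n. L1_norm {a..b} (u n)) \<longlonglongrightarrow> 0"
proof -
  \<comment> \<open>Measurability of \<open>u n\<close> is known only on the interval, so the
    integrands carry the indicator.\<close>
  have [measurable]: "(\<lambda>x. indicator {a..b} x * u n x) \<in> borel_measurable borel" for n
    using meas[of n] by (simp add: set_borel_measurable_def)
  have eq: "L1_norm {a..b} (u n) = (\<integral>\<^sup>+x. ennreal \<bar>indicator {a..b} x * u n x\<bar> \<partial>lborel)" for n
    unfolding L1_norm_def by (intro nn_integral_cong) (simp add: indicator_def)
  have "(\<lambda>n. \<integral>\<^sup>+x. ennreal \<bar>indicator {a..b} x * u n x\<bar> \<partial>lborel) \<longlonglongrightarrow> (\<integral>\<^sup>+x. 0 \<partial>(lborel :: real measure))"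
  proof (rule nn_integral_dominated_convergence[where w = "\<lambda>x. ennreal C * indicator {a..b} x"])
    show "AE x in lborel. ennreal \<bar>indicator {a..b} x * u n x\<bar> \<le> ennreal C * indicator {a..b} x" for n
      using bound by (auto simp: indicator_def intro!: ennreal_leI)
    show "(\<integral>\<^sup>+x. ennreal C * indicator {a..b} x \<partial>lborel) < \<infinity>"
      by (cases "a \<le> b") (auto simp: nn_integral_cmult ennreal_mult_less_top)
    \<comment> \<open>The endpoints, where no convergence is assumed, form a null set.\<close>
    have "AE x in lborel. x \<noteq> a \<and> x \<noteq> b"
      using AE_lborel_singleton[of a] AE_lborel_singleton[of b] by eventually_elim auto
    then show "AE x in lborel. (\<lambda>n. ennreal \<bar>indicator {a..b} x * u n x\<bar>) \<longlonglongrightarrow> 0"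
    proof eventually_elim
      case (elim x)
      then have "(\<lambda>n. \<bar>indicator {a..b} x * u n x\<bar>) \<longlonglongrightarrow> 0"
        using lim[of x] by (cases "x \<in> {a..b}") (auto intro: tendsto_rabs_zero)
      then show ?case by (simp add: ennreal_tendsto_0_iff)
    qed
  qed auto
  then show ?thesis by (simp add: eq)
qed

theorem proposition6p2:
  fixes M :: "'w measure"
    and X Y :: "nat \<Rightarrow> 'w \<Rightarrow> real"
    and a b \<beta> B :: real
    and K :: nat
    and pX :: "real \<Rightarrow> real"
    and lam :: "nat \<Rightarrow> real"
    and f m :: "nat \<Rightarrow> real \<Rightarrow> real"
    and phat :: "nat \<Rightarrow> (nat \<Rightarrow> real \<times> real) \<Rightarrow> real \<Rightarrow> real \<Rightarrow> real"
    and lamhat :: "nat \<Rightarrow> (nat \<Rightarrow> real \<times> real) \<Rightarrow> nat \<Rightarrow> real"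
    and fhat mhat :: "nat \<Rightarrow> (nat \<Rightarrow> real \<times> real) \<Rightarrow> nat \<Rightarrow> real \<Rightarrow> real"
  assumes "prob_space M" and "a < b" and "K \<ge> 1"
    and indep: "prob_space.indep_vars M (\<lambda>_. borel) (\<lambda>i \<omega>. (X i \<omega>, Y i \<omega>)) {1..}"
    and distr: "\<And>i. i \<ge> 1 \<Longrightarrow> distributed M lborel (\<lambda>\<omega>. (X i \<omega>, Y i \<omega>))
          (\<lambda>(x, y). ennreal (indicator {a..b} x * (pX x * cond_density K lam f m x y)))"
    and pX: "prob_density_on {a..b} pX" "(INF x\<in>{a..b}. pX x) > 0"
    and f: "\<And>k. k \<in> {1..K} \<Longrightarrow> prob_density_on UNIV (f k)"
           "\<And>k. k \<in> {1..K} \<Longrightarrow> has_bochner_integral lborel (\<lambda>y. y * f k y) 0"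
    and lam: "(MIN k\<in>{1..K}. lam k) > 0" "(\<Sum>k\<in>{1..K}. lam k) = 1"
    and m: "\<And>k. k \<in> {1..K} \<Longrightarrow> continuous_on {a..b} (m k)"
    and i: "\<beta> > 0"
           "holder_continuous_on \<beta> ({a..b} \<times> UNIV) (\<lambda>(x, y). pX x * cond_density K lam f m x y)"
    and ii: "\<And>j k. \<lbrakk>j \<in> {1..K}; k \<in> {1..K}; j \<noteq> k\<rbrakk> \<Longrightarrow> \<bar>lam j - lam k\<bar> > 0"
    and iii: "\<And>j k. \<lbrakk>j \<in> {1..K}; k \<in> {1..K}; j \<noteq> k\<rbrakk> \<Longrightarrow>
                ratio_limit_zero_or_infinity (char_fun (f j)) (char_fun (f k))"
    and phat: "\<And>n \<omega> x. \<lbrakk>n \<ge> 1; \<omega> \<in> space M; x \<in> {a..b}\<rbrakk> \<Longrightarrow>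
                phat n (sample X Y n \<omega>) x \<in> borel_measurable borel"
    and fhat: "\<And>n \<omega> k. \<lbrakk>n \<ge> 1; \<omega> \<in> space M; k \<in> {1..K}\<rbrakk> \<Longrightarrow>
                prob_density_on UNIV (fhat n (sample X Y n \<omega>) k)"
    and phat_lim: "AE \<omega> in M. \<forall>x\<in>{a<..<b}.
          (\<lambda>n. L1_norm UNIV (\<lambda>y. phat n (sample X Y n \<omega>) x y - cond_density K lam f m x y))
            \<longlonglongrightarrow> 0"
    and lamhat_fhat_lim: "AE \<omega> in M.
          (\<lambda>n. MAX k\<in>{1..K}. max (ennreal \<bar>lamhat n (sample X Y n \<omega>) k - lam k\<bar>)
                 (L1_norm UNIV (\<lambda>y. fhat n (sample X Y n \<omega>) k y - f k y)))
            \<longlonglongrightarrow> 0"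
    and B: "\<And>k x. \<lbrakk>k \<in> {1..K}; x \<in> {a..b}\<rbrakk> \<Longrightarrow> \<bar>m k x\<bar> \<le> B"
    and mhat_measurable: "\<And>n \<omega> k. \<lbrakk>n \<ge> 1; \<omega> \<in> space M; k \<in> {1..K}\<rbrakk> \<Longrightarrow>
          set_borel_measurable borel {a..b} (mhat n (sample X Y n \<omega>) k)"
    and mhat_argmin: "\<And>n \<omega> x. \<lbrakk>n \<ge> 1; \<omega> \<in> space M; x \<in> {a..b}\<rbrakk> \<Longrightarrow>
          is_arg_min
            (\<lambda>\<theta>. L1_norm UNIV (\<lambda>y.
               location_mixture K (lamhat n (sample X Y n \<omega>)) (fhat n (sample X Y n \<omega>)) \<theta> y
                 - phat n (sample X Y n \<omega>) x y))
            (\<lambda>\<theta>. \<theta> \<in> {1..K} \<rightarrow> {-B..B})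
            (\<lambda>k. mhat n (sample X Y n \<omega>) k x)"
  shows "AE \<omega> in M.
           (\<lambda>n. MAX k\<in>{1..K}. L1_norm {a..b} (\<lambda>x. mhat n (sample X Y n \<omega>) k x - m k x))
             \<longlonglongrightarrow> 0"
proof -
  have lam_pos: "lam k > 0" if "k \<in> {1..K}" for k
    using lam(1) that \<open>K \<ge> 1\<close> by (subst (asm) Min_gr_iff) auto
  \<comment> \<open>In \<open>phat_lim\<close> the quantifier over \<open>x\<close> lies inside the
    almost sure statement, so a single exceptional null set serves all \<open>x\<close> and the
    sample point can be fixed first.\<close>
  from phat_lim lamhat_fhat_lim show ?thesis
    using AE_space
  proof eventually_elim
    case (elim \<omega>)
    \<comment> \<open>The estimators are constrained only for \<open>n \<ge> 1\<close>, whereas the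
      lemmas ask for hypotheses at every natural number; the shift by one reconciles this and is
      undone at the end.\<close>
    define Z where "Z n = sample X Y (Suc n) \<omega>" for n
    have mhat: "is_arg_min
        (\<lambda>\<theta>. L1_norm UNIV (\<lambda>y. location_mixture K (lamhat (Suc n) (Z n)) (fhat (Suc n) (Z n)) \<theta> y
           - phat (Suc n) (Z n) x y))
        (\<lambda>\<theta>. \<theta> \<in> {1..K} \<rightarrow> {-B..B}) (\<lambda>k. mhat (Suc n) (Z n) k x)" if "x \<in> {a..b}" for n x
      unfolding Z_def using elim(3) that by (intro mhat_argmin) auto
    have pointwise: "(\<lambda>n. mhat (Suc n) (Z n) k x) \<longlonglongrightarrow> m k x"
      if x: "x \<in> {a<..<b}" and k: "k \<in> {1..K}" for k x
    proof (rule minimizer_tendsto[where f = f and w = lam and \<eta> = "\<lambda>k. m k x" and k = k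
          and v = "\<lambda>n. lamhat (Suc n) (Z n)" and g = "\<lambda>n. fhat (Suc n) (Z n)"
          and q = "\<lambda>n. phat (Suc n) (Z n) x"])
      show "(\<lambda>n. L1_norm UNIV (\<lambda>y. phat (Suc n) (Z n) x y - location_mixture K lam f (\<lambda>k. m k x) y))
          \<longlonglongrightarrow> 0"
        using elim(1) x unfolding Z_def cond_density_def by (intro LIMSEQ_Suc) auto
      show "(\<lambda>n. MAX k\<in>{1..K}. max (ennreal \<bar>lamhat (Suc n) (Z n) k - lam k\<bar>)
              (L1_norm UNIV (\<lambda>y. fhat (Suc n) (Z n) k y - f k y))) \<longlonglongrightarrow> 0"
        using LIMSEQ_Suc[OF elim(2)] by (simp add: Z_def)
      show "(\<lambda>k. m k x) \<in> {1..K} \<rightarrow> {-B..B}"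
        using B[of _ x] x by (fastforce simp: abs_le_iff)
      show "prob_density_on UNIV (fhat (Suc n) (Z n) k)" if "k \<in> {1..K}" for n k
        unfolding Z_def using elim(3) that by (intro fhat) auto
      show "phat (Suc n) (Z n) x \<in> borel_measurable borel" for n
        unfolding Z_def using elim(3) x by (intro phat) auto
      show "lam k \<noteq> 0" if "k \<in> {1..K}" for k
        using lam_pos[OF that] by simp
    qed (use mhat x k f(1) iii in auto)
    have L1_lim: "(\<lambda>n. L1_norm {a..b} (\<lambda>x. mhat (Suc n) (Z n) k x - m k x)) \<longlonglongrightarrow> 0"
      if k: "k \<in> {1..K}" for k
    proof (rule L1_norm_interval_tendsto_0)
      have "set_borel_measurable borel {a..b} (m k)"
        unfolding set_borel_measurable_def
        using m[OF k] by (intro borel_measurable_continuous_on_indicator) auto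
      moreover have "set_borel_measurable borel {a..b} (mhat (Suc n) (Z n) k)" for n
        unfolding Z_def using elim(3) k by (intro mhat_measurable) auto
      ultimately show "set_borel_measurable borel {a..b} (\<lambda>x. mhat (Suc n) (Z n) k x - m k x)" for n
        by (simp add: set_borel_measurable_def right_diff_distrib)
      \<comment> \<open>Both terms lie in \<open>{-B..B}\<close>, the estimator by feasibility of
        the minimizer; this gives the dominating constant.\<close>
      show "\<bar>mhat (Suc n) (Z n) k x - m k x\<bar> \<le> 2 * B" if "x \<in> {a..b}" for n x
      proof -
        have "mhat (Suc n) (Z n) k x \<in> {-B..B}"
          using mhat[OF that, of n] k by (auto simp: is_arg_min_def)
        then show ?thesis using B[OF k that] by auto
      qed
      show "(\<lambda>n. mhat (Suc n) (Z n) k x - m k x) \<longlonglongrightarrow> 0" if "x \<in> {a<..<b}" for x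
        using pointwise[OF that k] by (simp add: LIM_zero)
    qed
    have "(\<lambda>n. MAX k\<in>{1..K}. L1_norm {a..b} (\<lambda>x. mhat (Suc n) (Z n) k x - m k x)) \<longlonglongrightarrow> 0"
    \<comment> \<open>The maximum of finitely many nonnegative terms is at most their sum, which
      tends to 0 term by term.\<close>
    proof (rule tendsto_sandwich[OF _ _ tendsto_const])
      show "(\<lambda>n. \<Sum>k\<in>{1..K}. L1_norm {a..b} (\<lambda>x. mhat (Suc n) (Z n) k x - m k x)) \<longlonglongrightarrow> 0"
        by (intro tendsto_null_sum L1_lim)
      show "\<forall>\<^sub>F n in sequentially. (MAX k\<in>{1..K}. L1_norm {a..b} (\<lambda>x. mhat (Suc n) (Z n) k x - m k x))
          \<le> (\<Sum>k\<in>{1..K}. L1_norm {a..b} (\<lambda>x. mhat (Suc n) (Z n) k x - m k x))"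
        using \<open>K \<ge> 1\<close> by (intro always_eventually allI Max.boundedI) (auto intro: member_le_sum)
    qed auto
    then show ?case
      unfolding Z_def by (rule LIMSEQ_imp_Suc)
  qed
qed

end
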